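(* Let $p>2$ be a prime, let $t$ be a positive divisor of $p-1$ and let $k$ be an integer with $1<k\le(p/2)^{1/2}$. Put $r_1(k)=\left\lfloor \frac{\log(p/2)}{2\log k}\right\rfloor$ and $s=s_1(k,t)=\max\left\{s'\in\mathbb{Z}_{\ge0}~:~\binom{r_1(k)+s'}{s'}\le t\right\}$. Then $$\#\{|x|~:~x\in V(k,t,1)\}\le\tilde\Phi(k,s).$$
   Context: $\mathbb{F}_p$ is the field of residues modulo $p$. For $x\in\mathbb{F}_p$, the integer height is $|x|=\min\{|a|~:~a\in\mathbb{Z},\ a\equiv x\pmod p\}$ and the rational height is $\|x\|=\min\{\max(|a|,b)~:~a\in\mathbb{Z},\ b\in\mathbb{N},\ a\equiv bx \pmod p\}$. For $t\mid p-1$, $G$ is the unique subgroup of $\mathbb{F}_p^*$ of order $t$ and $V(k,t,1)=\{x\in G~:~\|x\|\le k\}$. $\Psi(x,y)$ is the number of positive integers $n\le x$ all of whose prime factors are at most $y$; $p_j$ is the $j$-th prime ($p_1=2$), with the convention $\Psi(x,p_0)=1$ for $x\ge 1$. For $s\in\mathbb{N}$, $\tilde\Phi(k,s)=\sum_{i=0}^{s}\binom{s}{i}\Psi(k,p_i)\Psi(k,p_{s-i})$, and $\tilde\Phi(k,0)=1$. *)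

theory Defs
  imports "HOL-Number_Theory.Number_Theory" "HOL-Algebra.Multiplicative_Group" Complex_Main
begin

text \<open>The field of residues modulo p is \<^term>\<open>residue_ring (int p)\<close>, whose elements are
  the integers \<open>0, \<dots>, p - 1\<close>.\<close>

definition integer_height :: "nat \<Rightarrow> int \<Rightarrow> nat" where
  "integer_height p x = (LEAST h. \<exists>a::int. [a = x] (mod int p) \<and> h = nat \<bar>a\<bar>)"

text \<open>The denominator \<open>b\<close> ranges over the positive integers; allowing \<open>b = 0\<close> would make
  every height zero.\<close>

definition rational_height :: "nat \<Rightarrow> int \<Rightarrow> nat" where
  "rational_height p x =
     (LEAST h. \<exists>(a::int) (b::nat). b > 0 \<and> [a = int b * x] (mod int p) \<and> h = max (nat \<bar>a\<bar>) b)"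

definition subgroup_of_order :: "nat \<Rightarrow> nat \<Rightarrow> int set" where
  "subgroup_of_order p t =
     (THE G. subgroup G (mult_of (residue_ring (int p))) \<and> card G = t)"

lemma ex1_subgroup_of_order:
  assumes "prime p" "t dvd p - 1"
  shows "\<exists>!G. subgroup G (mult_of (residue_ring (int p))) \<and> card G = t"
proof -
  define R where "R = residue_ring (int p)"
  interpret residues_prime p R
    by unfold_locales (use assms(1) in \<open>simp_all add: R_def\<close>)
  interpret M: group "mult_of R"
    rewrites "([^]\<^bsub>mult_of R\<^esub>) = (([^]\<^bsub>R\<^esub>) :: _ \<Rightarrow> nat \<Rightarrow> _)" and "\<one>\<^bsub>mult_of R\<^esub> = \<one>\<^bsub>R\<^esub>"
    by (rule field_mult_group) (simp_all add: fun_eq_iff nat_pow_mult_of)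
  have fin: "finite (carrier R)" by (simp add: R_def residue_ring_def)
  have p1: "p > 1" using assms(1) prime_gt_1_nat by blast
  have "t \<noteq> 0" using assms(2) p1 by (metis dvd_0_left zero_less_diff less_irrefl)
  have ord: "order (mult_of R) = p - 1"
    using order_mult_of[OF fin] p1 by (simp add: order_def R_def residue_ring_def)
  define T where "T = {x \<in> carrier R. x [^]\<^bsub>R\<^esub> t = \<one>\<^bsub>R\<^esub>}"
  have finT: "finite T" using fin by (simp add: T_def)
  have cardT: "card T \<le> t"
    unfolding T_def by (rule num_roots_le_deg[OF fin \<open>t \<noteq> 0\<close>])
  have eqT: "G = T" if G: "subgroup G (mult_of R)" "card G = t" for G
  proof -
    have sub: "G \<subseteq> carrier (mult_of R)" using G(1) subgroup.subset by blast
    have "G \<subseteq> T"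
    proof
      fix x assume x: "x \<in> G"
      interpret K: group "(mult_of R)\<lparr>carrier := G\<rparr>"
        using G(1) M.subgroup_imp_group by blast
      have "x [^]\<^bsub>(mult_of R)\<lparr>carrier := G\<rparr>\<^esub> order ((mult_of R)\<lparr>carrier := G\<rparr>)
              = \<one>\<^bsub>(mult_of R)\<lparr>carrier := G\<rparr>\<^esub>"
        using x by (intro K.pow_order_eq_1) simp
      then have "x [^]\<^bsub>R\<^esub> t = \<one>\<^bsub>R\<^esub>"
        using G(2) by (simp add: order_def nat_pow_def)
      with x sub show "x \<in> T" by (auto simp: T_def)
    qed
    then show ?thesis using finT cardT G(2) by (metis card_seteq)
  qed
  obtain g where g: "g \<in> carrier (mult_of R)"
    and gen: "carrier (mult_of R) = {g [^]\<^bsub>R\<^esub> i | i::nat. i \<in> UNIV}"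
    using finite_field_mult_group_has_gen[OF fin] by blast
  have "generate (mult_of R) {g} = carrier (mult_of R)"
  proof
    show "generate (mult_of R) {g} \<subseteq> carrier (mult_of R)"
      using g by (intro M.generate_incl) simp
    have "g [^]\<^bsub>R\<^esub> i \<in> generate (mult_of R) {g}" for i :: nat
    proof (induction i)
      case 0
      show ?case using generate.one[of "mult_of R" "{g}"] by simp
    next
      case (Suc i)
      then show ?case
        using generate.eng[OF Suc generate.incl[of g "{g}" "mult_of R"]] by simp
    qed
    then show "carrier (mult_of R) \<subseteq> generate (mult_of R) {g}" using gen by auto
  qed
  then have ordg: "group.ord (mult_of R) g = p - 1"
    using M.generate_pow_card[OF g] ord by (simp add: order_def)
  define a where "a = g [^]\<^bsub>R\<^esub> ((p - 1) div t)"
  have a: "a \<in> carrier (mult_of R)" "group.ord (mult_of R) a = t"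
  proof -
    show "a \<in> carrier (mult_of R)" using gen by (auto simp: a_def)
    obtain c where c: "p - 1 = t * c" using assms(2) by blast
    have "c \<noteq> 0" using c p1 by (metis mult_0_right zero_less_diff less_irrefl)
    with c \<open>t \<noteq> 0\<close> show "group.ord (mult_of R) a = t"
      using M.ord_pow[OF g, of c] ordg by (simp add: a_def)
  qed
  have "subgroup (generate (mult_of R) {a}) (mult_of R)"
    using a(1) by (intro M.generate_is_subgroup) simp
  moreover have "card (generate (mult_of R) {a}) = t"
    using M.generate_pow_card[OF a(1)] a(2) by simp
  ultimately show ?thesis using eqT unfolding R_def by blast
qed

definition V1 :: "nat \<Rightarrow> nat \<Rightarrow> nat \<Rightarrow> int set" where
  "V1 p k t = {x \<in> subgroup_of_order p t. rational_height p x \<le> k}"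

definition Psi :: "real \<Rightarrow> real \<Rightarrow> nat" where
  "Psi x y = card {n::nat. n > 0 \<and> real n \<le> x \<and> (\<forall>q. prime q \<and> q dvd n \<longrightarrow> real q \<le> y)}"

text \<open>Primes are indexed from \<open>1\<close>, so \<open>nth_prime 1 = 2\<close>; the value at \<open>0\<close> is never used.\<close>

definition nth_prime :: "nat \<Rightarrow> nat" where
  "nth_prime j = enumerate {q::nat. prime q} (j - 1)"

text \<open>\<open>Psi_prime x j\<close> is \<open>\<Psi>(x, p\<^sub>j)\<close>, with the convention \<open>\<Psi>(x, p\<^sub>0) = 1\<close> for \<open>x \<ge> 1\<close>.\<close>

definition Psi_prime :: "real \<Rightarrow> nat \<Rightarrow> nat" where
  "Psi_prime x j = (if j = 0 then 1 else Psi x (real (nth_prime j)))"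

definition Phi_tilde :: "nat \<Rightarrow> nat \<Rightarrow> nat" where
  "Phi_tilde k s = (\<Sum>i = 0..s. (s choose i) * Psi_prime (real k) i * Psi_prime (real k) (s - i))"

lemma Phi_tilde_0: "Phi_tilde k 0 = 1"
  by (simp add: Phi_tilde_def Psi_prime_def)

definition r1 :: "nat \<Rightarrow> nat \<Rightarrow> nat" where
  "r1 p k = nat \<lfloor>ln (real p / 2) / (2 * ln (real k))\<rfloor>"

text \<open>For \<open>r1 p k \<ge> 1\<close> and \<open>t \<ge> 1\<close> the set below is finite and contains \<open>0\<close>, so
  \<^const>\<open>Max\<close> is its genuine maximum.\<close>

definition s1 :: "nat \<Rightarrow> nat \<Rightarrow> nat \<Rightarrow> nat" where
  "s1 p k t = Max {s'. (r1 p k + s') choose s' \<le> t}"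

end

theory Submission
  imports Defs
begin

text \<open>Write each \<open>x \<in> V(k,t,1)\<close> as a reduced fraction \<open>a/b\<close> modulo \<open>p\<close> with \<open>|a|, b \<le> k\<close>, and attach to it
  the vector of exponents of \<open>|a|/b\<close> at the primes. If \<open>m\<close> of these vectors are linearly independent, the
  monomials of degree at most \<open>r = r\<^sub>1(k)\<close> in the corresponding elements are distinct rationals with
  numerators and denominators at most \<open>k^r\<close>; as \<open>2 k^(2r) < p\<close>, they remain distinct modulo \<open>p\<close>. They
  lie in \<open>G\<close>, so \<open>binom(r + m, m) \<le> t\<close> and \<open>m \<le> s\<close>. Hence the vectors span a space of dimension at
  most \<open>s\<close> and are determined by their coordinates at some \<open>s\<close> primes, so \<open>|x|\<close> is determined by
  the parts \<open>u, v\<close> of \<open>|a|, b\<close> composed of these primes. The numbers \<open>u, v \<le> k\<close> are coprime; splitting the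
  \<open>s\<close> primes into those dividing \<open>u\<close> and the others, and replacing each group by the smallest primes,
  bounds the number of pairs by \<open>\<Phi>(k, s)\<close>.\<close>

subsection \<open>Independent exponent vectors\<close>

text \<open>Take \<open>S\<close> and \<open>B\<close> of equal, maximal size such that the square matrix \<open>(v x q)\<close> is nonsingular.
  By maximality every \<open>v x\<close> agrees, on \<open>S\<close> and any one further coordinate, with a combination of
  the vectors in \<open>B\<close>, and the coefficients are already determined on \<open>S\<close>.\<close>

lemma exists_determining_coordinates:
  fixes v :: "'a \<Rightarrow> 'b \<Rightarrow> 'c::field"
  assumes "finite V"
  obtains S B where "S \<subseteq> P" "finite S" "B \<subseteq> V" "card S = card B"
    and "\<forall>c. (\<forall>q\<in>S. (\<Sum>x\<in>B. c x * v x q) = 0) \<longrightarrow> (\<forall>x\<in>B. c x = 0)"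
    and "\<forall>x\<in>V. \<forall>y\<in>V. (\<forall>q\<in>S. v x q = v y q) \<longrightarrow> (\<forall>q\<in>P. v x q = v y q)"
proof -
  define nonsing where "nonsing S B \<longleftrightarrow>
    (\<forall>c. (\<forall>q\<in>S. (\<Sum>x\<in>B. c x * v x q) = 0) \<longrightarrow> (\<forall>x\<in>B. c x = 0))" for S B
  define good where "good m \<longleftrightarrow>
    (\<exists>S B. S \<subseteq> P \<and> finite S \<and> B \<subseteq> V \<and> card S = m \<and> card B = m \<and> nonsing S B)" for m
  have "good 0"
    unfolding good_def by (rule exI[of _ "{}"], rule exI[of _ "{}"]) (simp add: nonsing_def)
  moreover have "m \<le> card V" if "good m" for m
    using that card_mono[OF assms] unfolding good_def by metis
  ultimately obtain m where m: "good m" and max: "\<And>n. good n \<Longrightarrow> n \<le> m"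
    using ex_has_greatest_nat[of good 0 id "Suc (card V)"] by (auto simp: less_Suc_eq_le)
  obtain S B where SB: "S \<subseteq> P" "finite S" "B \<subseteq> V" "card S = m" "card B = m" and ns: "nonsing S B"
    using m unfolding good_def by auto
  have finB: "finite B" using SB(3) assms finite_subset by blast
  \<comment> \<open>Only for \<open>x\<close> outside \<open>B\<close> does
    \<open>insert x B\<close> exceed \<open>B\<close> and contradict maximality; a member of
    \<open>B\<close> is trivially a combination, with unit coefficients.\<close>
  have comb: "\<exists>c. \<forall>q'\<in>insert q S. v x q' = (\<Sum>b\<in>B. c b * v b q')"
    if x: "x \<in> V" and q: "q \<in> P" "q \<notin> S" for x q
  proof (cases "x \<in> B")
    case True
    have "(\<Sum>b\<in>B. (if b = x then 1 else 0) * v b q') = v x q'" for q'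
    proof -
      have "(\<Sum>b\<in>B. (if b = x then 1 else 0) * v b q') = (\<Sum>b\<in>B. if b = x then v b q' else 0)"
        by (rule sum.cong) auto
      then show ?thesis using True finB by simp
    qed
    then show ?thesis by (intro exI[of _ "\<lambda>b. if b = x then 1 else 0"]) simp
  next
    case False
    have "\<not> nonsing (insert q S) (insert x B)"
    proof
      assume "nonsing (insert q S) (insert x B)"
      then have "good (Suc m)"
        unfolding good_def using SB x q False finB
        by (intro exI[of _ "insert q S"] exI[of _ "insert x B"]) auto
      then show False using max by fastforce
    qed
    then obtain c where c: "\<And>q'. q' \<in> insert q S \<Longrightarrow> (\<Sum>b\<in>insert x B. c b * v b q') = 0"
      and ne: "\<exists>b\<in>insert x B. c b \<noteq> 0"
      unfolding nonsing_def by blast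
    have c': "c x * v x q' + (\<Sum>b\<in>B. c b * v b q') = 0" if "q' \<in> insert q S" for q'
      using c[OF that] False finB by simp
    have cx: "c x \<noteq> 0"
    proof
      assume 0: "c x = 0"
      then have "\<forall>q'\<in>S. (\<Sum>b\<in>B. c b * v b q') = 0" using c' by simp
      then have "\<forall>b\<in>B. c b = 0" using ns unfolding nonsing_def by blast
      then show False using ne 0 by auto
    qed
    have "v x q' = (\<Sum>b\<in>B. (- c b / c x) * v b q')" if "q' \<in> insert q S" for q'
    proof -
      have "(\<Sum>b\<in>B. (- c b / c x) * v b q') = - (\<Sum>b\<in>B. c b * v b q') / c x"
        by (simp add: sum_divide_distrib sum_negf)
      also have "- (\<Sum>b\<in>B. c b * v b q') = c x * v x q'"
        using c'[OF that] by (simp add: add_eq_0_iff2)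
      finally show ?thesis using cx by simp
    qed
    then show ?thesis by (intro exI[of _ "\<lambda>b. - c b / c x"]) simp
  qed
  have det: "v x q = v y q"
    if xy: "x \<in> V" "y \<in> V" and eq: "\<And>q. q \<in> S \<Longrightarrow> v x q = v y q" and q: "q \<in> P" for x y q
  proof (cases "q \<in> S")
    case False
    obtain c where c: "\<forall>q'\<in>insert q S. v x q' = (\<Sum>b\<in>B. c b * v b q')"
      using comb[OF xy(1) q False] by blast
    obtain d where d: "\<forall>q'\<in>insert q S. v y q' = (\<Sum>b\<in>B. d b * v b q')"
      using comb[OF xy(2) q False] by blast
    \<comment> \<open>The coefficients \<open>c\<close> and \<open>d\<close> may depend on
      \<open>q\<close>, but \<open>v x\<close> and \<open>v y\<close> agree on \<open>S\<close>, so
      their difference is a relation on \<open>S\<close>. Nonsingularity there makes the two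
      combinations equal, hence also at \<open>q\<close>.\<close>
    have "\<forall>q'\<in>S. (\<Sum>b\<in>B. (c b - d b) * v b q') = 0"
      using c d eq by (simp add: left_diff_distrib sum_subtractf)
    then have "\<forall>b\<in>B. c b - d b = 0"
      using ns[unfolded nonsing_def, rule_format, of "\<lambda>b. c b - d b"] by simp
    then show ?thesis using c d by simp
  qed (simp add: eq)
  then have "\<forall>x\<in>V. \<forall>y\<in>V. (\<forall>q\<in>S. v x q = v y q) \<longrightarrow> (\<forall>q\<in>P. v x q = v y q)" by blast
  moreover have "card S = card B" using SB by simp
  ultimately show thesis using that SB(1-3) ns unfolding nonsing_def by blast
qed

text \<open>The left side counts the monomials of degree at most \<open>r\<close> in
  \<open>card B\<close> variables; they have distinct residues in \<open>G\<close>. Residues are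
  compared by cross-multiplication, which avoids inverses modulo \<open>M\<close>.\<close>

lemma binomial_le_card_if_independent:
  fixes num x :: "'a \<Rightarrow> int" and den :: "'a \<Rightarrow> nat" and k r :: nat and M :: int
  assumes fin: "finite B" and finG: "finite G"
    and num: "\<And>b. b \<in> B \<Longrightarrow> num b \<noteq> 0 \<and> nat \<bar>num b\<bar> \<le> k"
    and den: "\<And>b. b \<in> B \<Longrightarrow> den b > 0 \<and> den b \<le> k"
    and cong: "\<And>b. b \<in> B \<Longrightarrow> [num b = int (den b) * x b] (mod M)"
    and M: "2 * int k ^ (2 * r) < M" and k: "k > 0"
    and closed: "\<And>e :: 'a \<Rightarrow> nat. (\<Prod>b\<in>B. x b ^ e b) mod M \<in> G"
    and indep: "\<And>c :: 'a \<Rightarrow> rat. (\<And>q. prime q \<Longrightarrow> (\<Sum>b\<in>B. c b *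
        (of_nat (multiplicity q (nat \<bar>num b\<bar>)) - of_nat (multiplicity q (den b)))) = 0)
        \<Longrightarrow> \<forall>b\<in>B. c b = 0"
  shows "(r + card B) choose card B \<le> card G"
proof -
  define X where "X e = (\<Prod>b\<in>B. x b ^ e b)" for e :: "'a \<Rightarrow> nat"
  define N where "N e = (\<Prod>b\<in>B. num b ^ e b)" for e :: "'a \<Rightarrow> nat"
  define D where "D e = (\<Prod>b\<in>B. den b ^ e b)" for e :: "'a \<Rightarrow> nat"
  have NDX: "[N e = int (D e) * X e] (mod M)" for e
  proof -
    have "[N e = (\<Prod>b\<in>B. (int (den b) * x b) ^ e b)] (mod M)"
      unfolding N_def by (intro cong_prod cong_pow cong)
    then show ?thesis by (simp add: D_def X_def power_mult_distrib prod.distrib)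
  qed
  have kpow: "(\<Prod>b\<in>B. k ^ e b) \<le> k ^ r" if "sum e B \<le> r" for e
    using that k by (simp add: power_sum[symmetric] power_increasing)
  have absN: "nat \<bar>N e\<bar> = (\<Prod>b\<in>B. nat \<bar>num b\<bar> ^ e b)" for e
  proof -
    have "int (nat \<bar>N e\<bar>) = int (\<Prod>b\<in>B. nat \<bar>num b\<bar> ^ e b)"
      by (simp add: N_def abs_prod power_abs prod_nonneg)
    then show ?thesis by (simp only: of_nat_eq_iff)
  qed
  have Nk: "nat \<bar>N e\<bar> \<le> k ^ r" and Dk: "D e \<le> k ^ r" if "sum e B \<le> r" for e
  proof -
    have "nat \<bar>N e\<bar> \<le> (\<Prod>b\<in>B. k ^ e b)"
      unfolding absN by (intro prod_mono) (use num in \<open>auto intro!: power_mono\<close>)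
    then show "nat \<bar>N e\<bar> \<le> k ^ r" using kpow[OF that] by linarith
    have "D e \<le> (\<Prod>b\<in>B. k ^ e b)"
      unfolding D_def by (intro prod_mono) (use den in \<open>auto intro!: power_mono\<close>)
    then show "D e \<le> k ^ r" using kpow[OF that] by linarith
  qed
  have inj: "e b = f b"
    if e: "sum e B \<le> r" and f: "sum f B \<le> r" and eq: "X e mod M = X f mod M" and b: "b \<in> B" for e f b
  proof -
    have "[N e * int (D f) = int (D e) * X e * int (D f)] (mod M)"
      by (intro cong_mult NDX cong_refl)
    also have "[int (D e) * X e * int (D f) = int (D e) * X f * int (D f)] (mod M)"
      using eq by (intro cong_mult cong_refl) (simp add: cong_def)
    also have "int (D e) * X f * int (D f) = (int (D f) * X f) * int (D e)" by simp
    also have "[(int (D f) * X f) * int (D e) = N f * int (D e)] (mod M)"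
      by (intro cong_mult cong_refl cong_sym[OF NDX])
    finally have dvd: "M dvd N e * int (D f) - N f * int (D e)"
      by (simp add: cong_iff_dvd_diff)
    have bound: "\<bar>N e' * int (D f')\<bar> \<le> int k ^ (2 * r)" if "sum e' B \<le> r" "sum f' B \<le> r" for e' f'
    proof -
      have "nat \<bar>N e'\<bar> * D f' \<le> k ^ r * k ^ r" using Nk Dk that by (intro mult_mono) auto
      then have "int (nat \<bar>N e'\<bar> * D f') \<le> int (k ^ r * k ^ r)" by (rule of_nat_mono)
      then show ?thesis by (simp add: abs_mult mult_2 power_add)
    qed
    \<comment> \<open>Each product is at most \<open>k ^ (2 * r)\<close> in absolute value; the
      factor 2 in the bound on \<open>M\<close> covers their difference. A multiple of
      \<open>M\<close> smaller than \<open>M\<close> in absolute value is zero.\<close>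
    have "\<bar>N e * int (D f) - N f * int (D e)\<bar> < M"
      using bound[OF e f] bound[OF f e] M by linarith
    with dvd have "N e * int (D f) = N f * int (D e)"
      using dvd_imp_le_int[of "N e * int (D f) - N f * int (D e)" M] by fastforce
    then have "nat \<bar>N e * int (D f)\<bar> = nat \<bar>N f * int (D e)\<bar>" by simp
    then have ND: "nat \<bar>N e\<bar> * D f = nat \<bar>N f\<bar> * D e" by (simp add: abs_mult nat_mult_distrib)
    \<comment> \<open>Absolute values forget the signs, but the multiplicities in \<open>ND\<close>
      at every prime still give a relation with coefficients \<open>e b - f b\<close>.\<close>
    have "(\<Sum>b\<in>B. (of_nat (e b) - of_nat (f b)) *
        (of_nat (multiplicity q (nat \<bar>num b\<bar>)) - of_nat (multiplicity q (den b)))) = (0::rat)"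
      if q: "prime q" for q
    proof -
      have mN: "multiplicity q (nat \<bar>N e\<bar>) = (\<Sum>b\<in>B. e b * multiplicity q (nat \<bar>num b\<bar>))" for e
        unfolding absN using q num fin
        by (subst prime_elem_multiplicity_prod_distrib)
          (auto simp: prime_elem_multiplicity_power_distrib image_iff intro!: sum.cong)
      have mD: "multiplicity q (D e) = (\<Sum>b\<in>B. e b * multiplicity q (den b))" for e
        unfolding D_def using q den fin
        by (subst prime_elem_multiplicity_prod_distrib)
          (auto simp: prime_elem_multiplicity_power_distrib image_iff intro!: sum.cong)
      have nz: "nat \<bar>N e\<bar> \<noteq> 0" "D e \<noteq> 0" for e
        unfolding absN D_def using num den fin by fastforce+
      have "multiplicity q (nat \<bar>N e\<bar>) + multiplicity q (D f)
          = multiplicity q (nat \<bar>N f\<bar>) + multiplicity q (D e)"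
        using arg_cong[OF ND, of "multiplicity q"] q nz
        by (simp add: prime_elem_multiplicity_mult_distrib)
      then have "of_nat (multiplicity q (nat \<bar>N e\<bar>) + multiplicity q (D f))
          = (of_nat (multiplicity q (nat \<bar>N f\<bar>) + multiplicity q (D e)) :: rat)" by simp
      then show ?thesis
        unfolding mN mD by (simp add: algebra_simps sum_subtractf sum.distrib)
    qed
    then have "\<forall>b\<in>B. of_nat (e b) - of_nat (f b) = (0::rat)" by (rule indep)
    then show ?thesis using b by simp
  qed
  define m where "m = card B"
  obtain h where h: "bij_betw h B {0..<m}"
    using ex_bij_betw_finite_nat[OF fin] by (auto simp: m_def)
  \<comment> \<open>The last entry of a list is slack: it turns degree at most \<open>r\<close> in
    \<open>m\<close> variables into sum exactly \<open>r\<close> over \<open>m + 1\<close> entries,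
    where the count is a single binomial coefficient.\<close>
  define L where "L = {l::nat list. length l = Suc m \<and> sum_list l = r}"
  have sumL: "(\<Sum>b\<in>B. l ! h b) + l ! m = r" if "l \<in> L" for l
  proof -
    have "(\<Sum>b\<in>B. l ! h b) = (\<Sum>i\<in>{0..<m}. l ! i)" by (rule sum.reindex_bij_betw[OF h])
    then show ?thesis using that by (auto simp: L_def sum_list_sum_nth)
  qed
  have "inj_on (\<lambda>l. X (\<lambda>b. l ! h b) mod M) L"
  proof (rule inj_onI)
    fix l l' assume l: "l \<in> L" and l': "l' \<in> L"
      and eqX: "X (\<lambda>b. l ! h b) mod M = X (\<lambda>b. l' ! h b) mod M"
    have eq: "l ! h b = l' ! h b" if "b \<in> B" for b
      using inj[OF _ _ eqX that] sumL[OF l] sumL[OF l'] le_add1 by metis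
    then have last: "l ! m = l' ! m" using sumL[OF l] sumL[OF l'] by simp
    show "l = l'"
    proof (rule nth_equalityI)
      show "length l = length l'" using l l' by (simp add: L_def)
      fix i assume "i < length l"
      then have "i = m \<or> i \<in> h ` B" using l bij_betw_imp_surj_on[OF h] by (auto simp: L_def)
      then show "l ! i = l' ! i" using eq last by auto
    qed
  qed
  moreover have "(\<lambda>l. X (\<lambda>b. l ! h b) mod M) ` L \<subseteq> G"
    using closed by (auto simp: X_def)
  ultimately have "card L \<le> card G" using finG by (rule card_inj_on_le)
  moreover have "card L = (r + m) choose m"
    using card_length_sum_list[of "Suc m" r] binomial_symmetric[of r "r + m"] by (simp add: L_def)
  ultimately show ?thesis by (simp add: m_def)
qed

subsection \<open>Counting smooth numbers\<close>

text \<open>An arbitrary set of primes takes the place of the bound in \<open>Psi\<close>, because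
  the determining coordinates need not be the smallest primes.\<close>

definition smooth_upto :: "nat \<Rightarrow> nat set \<Rightarrow> nat set" where
  "smooth_upto k I = {n. 0 < n \<and> n \<le> k \<and> prime_factors n \<subseteq> I}"

lemma finite_smooth_upto [simp]: "finite (smooth_upto k I)"
  by (rule finite_subset[of _ "{..k}"]) (auto simp: smooth_upto_def)

lemma prime_factors_subsetI:
  fixes n :: nat
  assumes "\<And>q. prime q \<Longrightarrow> q dvd n \<Longrightarrow> q \<in> I"
  shows "prime_factors n \<subseteq> I"
  using assms by (auto simp: in_prime_factors_iff)

lemma eq_if_multiplicity_eq_on_factors:
  fixes m n :: nat
  assumes "m > 0" "n > 0" "prime_factors m \<subseteq> I" "prime_factors n \<subseteq> I"
    and "\<And>q. q \<in> I \<Longrightarrow> multiplicity q m = multiplicity q n"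
  shows "m = n"
proof (rule multiplicity_eq_nat)
  fix q :: nat assume q: "prime q"
  show "multiplicity q m = multiplicity q n"
  proof (cases "q \<in> I")
    case False
    then have "\<not> q dvd m" "\<not> q dvd n"
      using assms q by (auto simp: in_prime_factors_iff)
    then show ?thesis by (simp add: not_dvd_imp_multiplicity_0)
  qed (use assms in auto)
qed (use assms in auto)

lemma prod_prime_power_multiplicity:
  fixes n :: nat
  assumes "n > 0" "finite I" "prime_factors n \<subseteq> I" "\<And>q. q \<in> I \<Longrightarrow> prime q"
  shows "(\<Prod>q\<in>I. q ^ multiplicity q n) = n"
proof (rule eq_if_multiplicity_eq_on_factors[of _ _ I])
  show "0 < (\<Prod>q\<in>I. q ^ multiplicity q n)"
    using assms(4) by (intro prod_pos) (simp add: prime_gt_0_nat)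
  show "prime_factors (\<Prod>q\<in>I. q ^ multiplicity q n) \<subseteq> I"
  proof (rule prime_factors_subsetI)
    fix q assume "prime q" "q dvd (\<Prod>q\<in>I. q ^ multiplicity q n)"
    then obtain q' where "q' \<in> I" "q dvd q' ^ multiplicity q' n"
      using assms(2) by (auto simp: prime_dvd_prod_iff)
    then show "q \<in> I" using assms(4) \<open>prime q\<close> primes_dvd_imp_eq prime_dvd_power by metis
  qed
  show "multiplicity q (\<Prod>q\<in>I. q ^ multiplicity q n) = multiplicity q n" if "q \<in> I" for q
    using multiplicity_prod_prime_powers[of I q "\<lambda>q. multiplicity q n"] assms that by auto
qed (use assms in auto)

text \<open>Replacing the primes in \<open>I\<close> by the first \<open>card I\<close> primes, in increasing order, does not
  increase any of the numbers.\<close>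

lemma card_smooth_upto_le:
  assumes "finite I" and prime: "\<And>q. q \<in> I \<Longrightarrow> prime q"
  shows "card (smooth_upto k I) \<le> Psi_prime (real k) (card I)"
proof (cases "I = {}")
  case True
  have "smooth_upto k I \<subseteq> {1}"
  proof
    fix n assume "n \<in> smooth_upto k I"
    then have n: "n > 0" "prime_factors n \<subseteq> {}" using True by (auto simp: smooth_upto_def)
    then show "n \<in> {1}" using eq_if_multiplicity_eq_on_factors[of n 1 "{}"] by simp
  qed
  then have "card (smooth_upto k I) \<le> card {1::nat}" by (intro card_mono) auto
  then show ?thesis using True by (simp add: Psi_prime_def)
next
  case False
  define E where "E = enumerate {q::nat. prime q}"
  have inf: "infinite {q::nat. prime q}" by (rule primes_infinite)
  \<comment> \<open>\<open>E\<close> counts from 0, so the \<open>i\<close>-th smallest element of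
    \<open>I\<close>, which has \<open>i - 1\<close> predecessors, goes to the \<open>i\<close>-th
    prime.\<close>
  define \<beta> where "\<beta> q = E (card {q' \<in> I. q' < q})" for q
  have prime_\<beta>: "prime (\<beta> q)" for q
    using enumerate_in_set[OF inf] by (simp add: \<beta>_def E_def)
  have \<beta>_mono: "\<beta> q < \<beta> q'" if "q \<in> I" "q' \<in> I" "q < q'" for q q'
  proof -
    have "card {x \<in> I. x < q} < card {x \<in> I. x < q'}"
      using that assms(1) by (intro psubset_card_mono) auto
    then show ?thesis using inf by (simp add: \<beta>_def E_def)
  qed
  then have inj: "inj_on \<beta> I" by (metis inj_onI less_irrefl linorder_neqE_nat)
  \<comment> \<open>If \<open>q = E n\<close>, the members of \<open>I\<close> below
    \<open>q\<close> are among the first \<open>n\<close> primes, so the index used in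
    \<open>\<beta> q\<close> is at most \<open>n\<close>.\<close>
  have \<beta>_le: "\<beta> q \<le> q" if q: "q \<in> I" for q
  proof -
    obtain n where n: "E n = q"
      using enumerate_Ex[OF inf, of q] prime[OF q] by (auto simp: E_def)
    have "{q' \<in> I. q' < q} \<subseteq> E ` {..<n}"
    proof
      fix q' assume q': "q' \<in> {q' \<in> I. q' < q}"
      then obtain n' where n': "E n' = q'"
        using enumerate_Ex[OF inf, of q'] prime by (auto simp: E_def)
      then have "n' < n" using q' n inf by (auto simp: E_def)
      then show "q' \<in> E ` {..<n}" using n' by auto
    qed
    then have "card {q' \<in> I. q' < q} \<le> card {..<n}" by (intro surj_card_le) auto
    then show ?thesis using n inf by (auto simp: \<beta>_def E_def)
  qed
  \<comment> \<open>The index is at most \<open>card I - 1\<close>, which is the shift built into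
    \<open>nth_prime\<close>.\<close>
  have \<beta>_bound: "\<beta> q \<le> nth_prime (card I)" if "q \<in> I" for q
  proof -
    have "card {q' \<in> I. q' < q} < card I"
      using that assms(1) by (intro psubset_card_mono) auto
    then show ?thesis using inf by (simp add: \<beta>_def E_def nth_prime_def)
  qed
  define \<phi> where "\<phi> n = (\<Prod>q\<in>I. \<beta> q ^ multiplicity q n)" for n
  \<comment> \<open>As \<open>\<beta>\<close> is injective on \<open>I\<close>, the factors of
    \<open>\<phi> n\<close> are powers of distinct primes and no exponent of \<open>n\<close> is
    lost.\<close>
  have mult_\<phi>: "multiplicity (\<beta> q) (\<phi> n) = multiplicity q n" if q: "q \<in> I" for q n
  proof -
    have "\<phi> n = (\<Prod>y\<in>\<beta> ` I. y ^ multiplicity (inv_into I \<beta> y) n)"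
      unfolding \<phi>_def using inj by (simp add: prod.reindex)
    also have "multiplicity (\<beta> q) \<dots> = multiplicity (inv_into I \<beta> (\<beta> q)) n"
      using q assms(1) prime_\<beta> by (subst multiplicity_prod_prime_powers) auto
    finally show ?thesis using inj q by simp
  qed
  define T where "T = {n::nat. n > 0 \<and> real n \<le> real k \<and>
    (\<forall>q. prime q \<and> q dvd n \<longrightarrow> real q \<le> real (nth_prime (card I)))}"
  have "finite T" by (rule finite_subset[of _ "{..k}"]) (auto simp: T_def)
  moreover have "inj_on \<phi> (smooth_upto k I)"
  proof (rule inj_onI)
    fix m n assume mn: "m \<in> smooth_upto k I" "n \<in> smooth_upto k I" and eq: "\<phi> m = \<phi> n"
    show "m = n"
      by (rule eq_if_multiplicity_eq_on_factors[of _ _ I])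
        (use mn mult_\<phi>[of _ m] mult_\<phi>[of _ n] eq in \<open>auto simp: smooth_upto_def\<close>)
  qed
  moreover have "\<phi> n \<in> T" if "n \<in> smooth_upto k I" for n
  proof -
    have n: "n > 0" "n \<le> k" "prime_factors n \<subseteq> I" using that by (auto simp: smooth_upto_def)
    have "\<phi> n \<le> (\<Prod>q\<in>I. q ^ multiplicity q n)"
      unfolding \<phi>_def by (intro prod_mono) (auto intro!: power_mono \<beta>_le)
    also have "\<dots> = n" using n assms by (intro prod_prime_power_multiplicity) auto
    finally have "\<phi> n \<le> k" using n by simp
    moreover have "\<phi> n > 0"
      unfolding \<phi>_def using prime_\<beta> by (intro prod_pos) (simp add: prime_gt_0_nat)
    moreover have "q \<le> nth_prime (card I)" if q: "prime q" "q dvd \<phi> n" for q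
    proof -
      obtain q' where "q' \<in> I" "q dvd \<beta> q' ^ multiplicity q' n"
        using q assms(1) by (auto simp: \<phi>_def prime_dvd_prod_iff)
      then show ?thesis
        using \<beta>_bound q(1) prime_\<beta> primes_dvd_imp_eq prime_dvd_power by metis
    qed
    ultimately show ?thesis by (simp add: T_def)
  qed
  ultimately have "card (smooth_upto k I) \<le> card T"
    by (intro card_inj_on_le[of \<phi>]) auto
  moreover have "card I \<noteq> 0" using False assms(1) by simp
  ultimately show ?thesis by (simp add: Psi_prime_def Psi_def T_def)
qed

text \<open>A coprime pair lies in the block of \<open>I = prime_factors u\<close>, since the primes
  of \<open>v\<close> are then in \<open>S - I\<close>. Blocks may overlap, so their sizes only
  bound the count; grouping the \<open>I\<close> by cardinality produces the binomial
  coefficients.\<close>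

lemma card_coprime_smooth_pairs_le:
  assumes "finite S" and prime: "\<And>q. q \<in> S \<Longrightarrow> prime q"
  shows "card {(u, v). u \<in> smooth_upto k S \<and> v \<in> smooth_upto k S \<and> coprime u v}
    \<le> Phi_tilde k (card S)"
    (is "card ?C \<le> _")
proof -
  define g where "g i = Psi_prime (real k) i * Psi_prime (real k) (card S - i)" for i
  have "?C \<subseteq> (\<Union>I\<in>Pow S. smooth_upto k I \<times> smooth_upto k (S - I))"
  proof (clarify)
    fix u v assume uv: "u \<in> smooth_upto k S" "v \<in> smooth_upto k S" "coprime u v"
    have "prime_factors v \<inter> prime_factors u = {}"
      using uv(3) by (auto simp: in_prime_factors_iff) (metis coprime_common_divisor not_prime_unit)
    then have "u \<in> smooth_upto k (prime_factors u)" "v \<in> smooth_upto k (S - prime_factors u)"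
      "prime_factors u \<in> Pow S"
      using uv by (auto simp: smooth_upto_def)
    then show "(u, v) \<in> (\<Union>I\<in>Pow S. smooth_upto k I \<times> smooth_upto k (S - I))" by blast
  qed
  then have "card ?C \<le> card (\<Union>I\<in>Pow S. smooth_upto k I \<times> smooth_upto k (S - I))"
    using assms(1) by (intro card_mono) auto
  also have "\<dots> \<le> (\<Sum>I\<in>Pow S. card (smooth_upto k I \<times> smooth_upto k (S - I)))"
    using assms(1) by (intro card_UN_le) auto
  also have "\<dots> \<le> (\<Sum>I\<in>Pow S. g (card I))"
  proof (rule sum_mono)
    fix I assume I: "I \<in> Pow S"
    then have "finite I" using assms(1) finite_subset by blast
    then have "card (S - I) = card S - card I" using I by (intro card_Diff_subset) auto
    then have "card (smooth_upto k (S - I)) \<le> Psi_prime (real k) (card S - card I)"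
      using card_smooth_upto_le[of "S - I" k] assms by simp
    moreover have "card (smooth_upto k I) \<le> Psi_prime (real k) (card I)"
      using card_smooth_upto_le[of I k] \<open>finite I\<close> I prime by auto
    ultimately show "card (smooth_upto k I \<times> smooth_upto k (S - I)) \<le> g (card I)"
      by (simp add: g_def card_cartesian_product mult_mono)
  qed
  also have "\<dots> = (\<Sum>i\<in>{0..card S}. \<Sum>I\<in>{I \<in> Pow S. card I = i}. g (card I))"
    using assms(1) by (intro sum.group[symmetric]) (auto simp: card_mono)
  also have "\<dots> = (\<Sum>i\<in>{0..card S}. (card S choose i) * g i)"
    using assms(1) by (intro sum.cong) (simp_all add: n_subsets)
  also have "\<dots> = Phi_tilde k (card S)" by (simp add: Phi_tilde_def g_def mult.assoc)
  finally show ?thesis .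
qed

subsection \<open>Heights and the subgroup of order t\<close>

lemma integer_height_cong:
  assumes "[x = y] (mod int p)"
  shows "integer_height p x = integer_height p y"
proof -
  have "[a = x] (mod int p) \<longleftrightarrow> [a = y] (mod int p)" for a
    using assms cong_trans cong_sym by blast
  then show ?thesis by (simp add: integer_height_def)
qed

text \<open>Exponent vectors see a fraction only up to sign; this symmetry absorbs the
  ambiguity.\<close>

lemma integer_height_minus: "integer_height p (- x) = integer_height p x"
proof -
  have "(\<exists>a. [a = - x] (mod int p) \<and> h = nat \<bar>a\<bar>) \<longleftrightarrow> (\<exists>a. [a = x] (mod int p) \<and> h = nat \<bar>a\<bar>)" for h
    by (metis abs_minus_cancel cong_minus_minus_iff minus_minus)
  then show ?thesis by (simp add: integer_height_def)
qed

text \<open>The bound \<open>k < p\<close> makes both the gcd and the reduced denominator invertible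
  modulo \<open>p\<close>: the former can then be cancelled, and the latter keeps the numerator
  nonzero.\<close>

lemma rational_height_reduced_fraction:
  assumes p: "prime p" and k: "k < p" and x: "\<not> int p dvd x" and h: "rational_height p x \<le> k"
  obtains a :: int and b :: nat
  where "a \<noteq> 0" "nat \<bar>a\<bar> \<le> k" "b > 0" "b \<le> k" "coprime (nat \<bar>a\<bar>) b" "[a = int b * x] (mod int p)"
proof -
  define Q where "Q h \<longleftrightarrow> (\<exists>(a::int) (b::nat). b > 0 \<and> [a = int b * x] (mod int p) \<and>
    h = max (nat \<bar>a\<bar>) b)" for h
  \<comment> \<open>The fraction \<open>x / 1\<close> attains some height, so \<open>LEAST\<close>
    is taken over a nonempty set.\<close>
  have "Q (max (nat \<bar>x\<bar>) 1)" unfolding Q_def by (rule exI[of _ x], rule exI[of _ 1]) simp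
  then have "Q (rational_height p x)" unfolding rational_height_def Q_def by (rule LeastI)
  then obtain a b where ab: "b > 0" "[a = int b * x] (mod int p)" "rational_height p x = max (nat \<bar>a\<bar>) b"
    unfolding Q_def by blast
  define g where "g = gcd (nat \<bar>a\<bar>) b"
  have g: "g > 0" "g dvd nat \<bar>a\<bar>" "g dvd b"
    using ab(1) unfolding g_def by (simp, blast+)
  obtain b' where b': "b = g * b'" using g(3) by blast
  have "int g dvd a" using g(2) by (metis int_dvd_int_iff dvd_abs_iff int_nat_eq abs_ge_zero)
  then obtain a' where a': "a = int g * a'" by blast
  have bp: "b < p" using ab(3) h k by simp
  then have "g < p" using dvd_imp_le[OF g(3) ab(1)] by linarith
  then have "coprime g p" using p g(1)
    by (metis coprime_commute nat_dvd_not_less prime_imp_coprime)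
  then have cop: "coprime (int g) (int p)" by simp
  have "[int g * a' = int g * (int b' * x)] (mod int p)"
    using ab(2) by (simp add: a' b' mult.assoc)
  then have cong: "[a' = int b' * x] (mod int p)" using cop by (simp add: cong_mult_lcancel)
  have pos: "b' > 0" using ab(1) b' by simp
  have b'k: "b' \<le> k"
    using ab(3) h g(1) b' by (metis dvd_imp_le ab(1) dvd_triv_right le_trans max.bounded_iff)
  have "nat \<bar>a\<bar> = g * nat \<bar>a'\<bar>" by (simp add: a' abs_mult nat_mult_distrib)
  moreover have "nat \<bar>a\<bar> \<le> k" using ab(3) h by simp
  moreover have "1 * nat \<bar>a'\<bar> \<le> g * nat \<bar>a'\<bar>" using g(1) by (intro mult_le_mono1) simp
  ultimately have a'k: "nat \<bar>a'\<bar> \<le> k" by linarith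
  have "g * gcd (nat \<bar>a'\<bar>) b' = g"
    using g_def unfolding \<open>nat \<bar>a\<bar> = g * nat \<bar>a'\<bar>\<close> b' gcd_mult_distrib_nat[symmetric] by (rule sym)
  then have copr: "coprime (nat \<bar>a'\<bar>) b'" using g(1) by (simp add: coprime_iff_gcd_eq_1)
  have "a' \<noteq> 0"
  proof
    assume "a' = 0"
    then have "int p dvd int b' * x" using cong by (metis cong_0_iff cong_sym)
    then have "int p dvd int b'" using p x by (simp add: prime_dvd_mult_iff)
    then show False using pos b'k k by (simp add: nat_dvd_not_less)
  qed
  then show ?thesis using a'k pos b'k copr cong by (rule that)
qed

lemma
  assumes "prime p" "t dvd p - 1"
  shows card_subgroup_of_order: "card (subgroup_of_order p t) = t"
    and subgroup_of_order_subset: "subgroup_of_order p t \<subseteq> {0<..<int p}"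
    and one_in_subgroup_of_order: "1 \<in> subgroup_of_order p t"
    and mult_in_subgroup_of_order: "\<And>x y. x \<in> subgroup_of_order p t \<Longrightarrow> y \<in> subgroup_of_order p t
      \<Longrightarrow> x * y mod int p \<in> subgroup_of_order p t"
proof -
  have *: "subgroup (subgroup_of_order p t) (mult_of (residue_ring (int p)))
      \<and> card (subgroup_of_order p t) = t"
    unfolding subgroup_of_order_def by (rule theI'[OF ex1_subgroup_of_order[OF assms]])
  then show "card (subgroup_of_order p t) = t" by simp
  interpret subgroup "subgroup_of_order p t" "mult_of (residue_ring (int p))" using * by simp
  show "subgroup_of_order p t \<subseteq> {0<..<int p}"
    using subset by (auto simp: residue_ring_def)
  show "1 \<in> subgroup_of_order p t" using one_closed by (simp add: residue_ring_def)
  show "x * y mod int p \<in> subgroup_of_order p t"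
    if "x \<in> subgroup_of_order p t" "y \<in> subgroup_of_order p t" for x y
    using m_closed[OF that] by (simp add: residue_ring_def)
qed

lemma prod_powers_in_subgroup_of_order:
  assumes "prime p" "t dvd p - 1" "finite B" "\<And>b. b \<in> B \<Longrightarrow> x b \<in> subgroup_of_order p t"
  shows "(\<Prod>b\<in>B. x b ^ e b) mod int p \<in> subgroup_of_order p t"
proof -
  note G = one_in_subgroup_of_order[OF assms(1,2)] mult_in_subgroup_of_order[OF assms(1,2)]
  have p1: "1 mod int p = 1" using assms(1) prime_gt_1_nat by force
  have mult: "(y * z) mod int p \<in> subgroup_of_order p t"
    if "y mod int p \<in> subgroup_of_order p t" "z mod int p \<in> subgroup_of_order p t" for y z
    using G(2)[OF that] by (simp add: mod_mult_eq)
  have pow: "(x b ^ n) mod int p \<in> subgroup_of_order p t" if b: "b \<in> B" for b and n :: nat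
  proof (induction n)
    case (Suc n)
    have "x b mod int p = x b"
      using subgroup_of_order_subset[OF assms(1,2)] assms(4)[OF b] by auto
    then show ?case using Suc mult[of "x b" "x b ^ n"] assms(4)[OF b] by simp
  qed (simp add: p1 G)
  show ?thesis using assms(3) pow
    by (induction B rule: finite_induct) (simp_all add: p1 G mult)
qed

section \<open>The parameters \<open>r1\<close> and \<open>s1\<close>\<close>

lemma rank_le_s1:
  assumes "(r1 p k + m) choose m \<le> t" "r1 p k > 0"
  shows "m \<le> s1 p k t"
proof -
  \<comment> \<open>For \<open>r1 p k > 0\<close> the binomial coefficient is at least
    \<open>s' + 1\<close>; this bounds the set in \<open>s1\<close>, so that \<open>Max\<close> is
    meaningful.\<close>
  have "s' \<le> t" if "(r1 p k + s') choose s' \<le> t" for s'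
  proof -
    have "Suc s' choose s' \<le> (r1 p k + s') choose s'"
      using assms(2) by (intro binomial_right_mono) simp
    then show ?thesis using that by simp
  qed
  then have "{s'. (r1 p k + s') choose s' \<le> t} \<subseteq> {..t}" by blast
  then have "finite {s'. (r1 p k + s') choose s' \<le> t}" using finite_atMost by (rule finite_subset)
  then show ?thesis unfolding s1_def using assms(1) by (intro Max_ge) simp_all
qed

text \<open>The hypothesis amounts to \<open>k ^ 2 \<le> p / 2\<close>, so the quotient of
  logarithms in \<open>r1\<close> is at least 1, and rounding it down keeps
  \<open>k ^ (2 * r1 p k) \<le> p / 2\<close>.\<close>

lemma
  assumes "1 < k" and "real k \<le> sqrt (real p / 2)"
  shows r1_pos: "r1 p k > 0" and two_power_r1_le: "2 * k ^ (2 * r1 p k) \<le> p"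
proof -
  have lnk: "ln (real k) > 0" using assms(1) by simp
  have k2: "real k ^ 2 \<le> real p / 2"
    using power_mono[OF assms(2), of 2] by simp
  have "real k ^ 2 > 0" using assms(1) by simp
  then have p2: "real p / 2 > 0" using k2 by linarith
  have "ln (real k ^ 2) \<le> ln (real p / 2)" using k2 \<open>real k ^ 2 > 0\<close> p2 by simp
  then have "2 * ln (real k) \<le> ln (real p / 2)" using assms(1) by (simp add: ln_realpow)
  then have ge1: "ln (real p / 2) / (2 * ln (real k)) \<ge> 1" using lnk by simp
  then show "r1 p k > 0" unfolding r1_def by simp
  have "real (r1 p k) \<le> ln (real p / 2) / (2 * ln (real k))"
    unfolding r1_def using ge1 by (simp add: of_nat_floor)
  then have "real (2 * r1 p k) * ln (real k) \<le> ln (real p / 2)"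
    using lnk by (simp add: field_simps)
  then have "ln (real k ^ (2 * r1 p k)) \<le> ln (real p / 2)"
    using assms(1) by (simp add: ln_realpow)
  then have "real k ^ (2 * r1 p k) \<le> real p / 2" using assms(1) p2 by simp
  then have "real (2 * k ^ (2 * r1 p k)) \<le> real p" by simp
  then show "2 * k ^ (2 * r1 p k) \<le> p" by (simp only: of_nat_le_iff)
qed

section \<open>Reduced fractions and smooth parts\<close>

lemma coprime_multiplicity_cases:
  fixes a b q :: nat
  assumes "coprime a b" "prime q"
  shows "multiplicity q a = 0 \<or> multiplicity q b = 0"
proof -
  have "\<not> q dvd a \<or> \<not> q dvd b"
    using assms coprime_common_divisor[of a b q] not_prime_unit[of q] by blast
  then show ?thesis by (auto simp: not_dvd_imp_multiplicity_0)
qed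

text \<open>By coprimality at most one of the two multiplicities is nonzero, so they are the
  positive and negative parts of their difference.\<close>

lemma coprime_fraction_multiplicity_eq:
  fixes a b a' b' q :: nat
  assumes "coprime a b" "coprime a' b'" "prime q"
    and "of_nat (multiplicity q a) - of_nat (multiplicity q b)
       = (of_nat (multiplicity q a') - of_nat (multiplicity q b') :: rat)"
  shows "multiplicity q a = multiplicity q a' \<and> multiplicity q b = multiplicity q b'"
proof -
  have "of_nat (multiplicity q a + multiplicity q b') = (of_nat (multiplicity q a' + multiplicity q b) :: rat)"
    using assms(4) by (simp add: algebra_simps)
  then have "multiplicity q a + multiplicity q b' = multiplicity q a' + multiplicity q b"
    by (simp only: of_nat_eq_iff)
  then show ?thesis
    using coprime_multiplicity_cases[OF assms(1,3)] coprime_multiplicity_cases[OF assms(2,3)] by auto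
qed

text \<open>For a finite set \<open>S\<close> of primes and \<open>n > 0\<close> this is the largest
  divisor of \<open>n\<close> with all prime factors in \<open>S\<close>.\<close>

definition smooth_part :: "nat set \<Rightarrow> nat \<Rightarrow> nat" where
  "smooth_part S n = (\<Prod>q\<in>S. q ^ multiplicity q n)"

context
  fixes S :: "nat set"
  assumes fin: "finite S" and prime: "\<And>q. q \<in> S \<Longrightarrow> prime q"
begin

lemma multiplicity_smooth_part:
  "prime q \<Longrightarrow> multiplicity q (smooth_part S n) = (if q \<in> S then multiplicity q n else 0)"
  unfolding smooth_part_def using fin prime by (intro multiplicity_prod_prime_powers) auto

lemma smooth_part_pos: "smooth_part S n > 0"
  unfolding smooth_part_def using prime by (intro prod_pos) (simp add: prime_gt_0_nat)

lemma smooth_part_dvd: "n > 0 \<Longrightarrow> smooth_part S n dvd n"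
  using smooth_part_pos[of n] by (intro multiplicity_le_imp_dvd) (auto simp: multiplicity_smooth_part)

lemma smooth_part_in_smooth_upto:
  assumes "n > 0" "n \<le> k"
  shows "smooth_part S n \<in> smooth_upto k S"
proof -
  have "smooth_part S n \<le> k" using dvd_imp_le[OF smooth_part_dvd] assms le_trans by blast
  moreover have "prime_factors (smooth_part S n) \<subseteq> S"
    using multiplicity_smooth_part by (auto simp: prime_factors_multiplicity split: if_splits)
  ultimately show ?thesis using smooth_part_pos by (simp add: smooth_upto_def)
qed

end

section \<open>Counting the integer heights\<close>

theorem theorem1p6:
  fixes p t k :: nat
  assumes "prime p" and "p > 2"
    and "t > 0" and "t dvd p - 1"
    and "1 < k" and "real k \<le> sqrt (real p / 2)"
  shows "card (integer_height p ` V1 p k t) \<le> Phi_tilde k (s1 p k t)"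
proof -
  define G where "G = subgroup_of_order p t"
  define V where "V = V1 p k t"
  define r where "r = r1 p k"
  have rpos: "r > 0" and rp: "2 * k ^ (2 * r) \<le> p"
    using r1_pos two_power_r1_le assms(5,6) by (auto simp: r_def)
  have "odd p" using assms(1,2) prime_odd_nat by auto
  \<comment> \<open>The left side is even and \<open>p\<close> is odd, which gives the strict
    inequality that distinctness modulo \<open>p\<close> requires.\<close>
  then have rp': "2 * k ^ (2 * r) < p" using rp by (metis dvd_triv_left le_neq_implies_less)
  have "k ^ 1 \<le> k ^ (2 * r)" using assms(5) rpos by (intro power_increasing) auto
  then have kp: "k < p" using rp' by simp
  have cardG: "card G = t" and Gsub: "G \<subseteq> {0<..<int p}"
    using card_subgroup_of_order subgroup_of_order_subset assms(1,4) by (simp_all add: G_def)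
  have finG: "finite G" using Gsub finite_subset by blast
  have VG: "V \<subseteq> G" by (auto simp: V_def G_def V1_def)
  then have finV: "finite V" using finG finite_subset by blast
  have "\<exists>a b. a \<noteq> 0 \<and> nat \<bar>a\<bar> \<le> k \<and> b > 0 \<and> b \<le> k \<and> coprime (nat \<bar>a\<bar>) b \<and> [a = int b * x] (mod int p)"
    if x: "x \<in> V" for x
  proof -
    have "0 < x" "x < int p" using x VG Gsub by auto
    then have "\<not> int p dvd x" by (rule zdvd_not_zless)
    moreover have "rational_height p x \<le> k" using x by (simp add: V_def V1_def)
    ultimately show ?thesis using rational_height_reduced_fraction[OF assms(1) kp] by metis
  qed
  then obtain num den where fr: "\<And>x. x \<in> V \<Longrightarrow> num x \<noteq> 0 \<and> nat \<bar>num x\<bar> \<le> k \<and> den x > 0 \<and> den x \<le> k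
      \<and> coprime (nat \<bar>num x\<bar>) (den x) \<and> [num x = int (den x) * x] (mod int p)"
    by metis
  define v :: "int \<Rightarrow> nat \<Rightarrow> rat" where
    "v x q = of_nat (multiplicity q (nat \<bar>num x\<bar>)) - of_nat (multiplicity q (den x))" for x q
  obtain S B where S: "S \<subseteq> {q. prime q}" "finite S" and B: "B \<subseteq> V" and SB: "card S = card B"
    and indep: "\<forall>c. (\<forall>q\<in>S. (\<Sum>x\<in>B. c x * v x q) = 0) \<longrightarrow> (\<forall>x\<in>B. c x = 0)"
    and det: "\<forall>x\<in>V. \<forall>y\<in>V. (\<forall>q\<in>S. v x q = v y q) \<longrightarrow> (\<forall>q\<in>{q. prime q}. v x q = v y q)"
    by (rule exists_determining_coordinates[OF finV])
  have finB: "finite B" using B finV finite_subset by blast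
  have "(r + card B) choose card B \<le> card G"
  proof (rule binomial_le_card_if_independent[where x = "\<lambda>x. x" and num = num and den = den and k = k
        and M = "int p"])
    show "2 * int k ^ (2 * r) < int p" using rp' by (metis of_nat_less_iff of_nat_mult of_nat_numeral of_nat_power)
    show "(\<Prod>b\<in>B. b ^ e b) mod int p \<in> G" for e
      using prod_powers_in_subgroup_of_order[OF assms(1,4) finB, of "\<lambda>x. x"] B VG
      by (auto simp: G_def)
    show "\<forall>b\<in>B. c b = 0"
      if "\<And>q. prime q \<Longrightarrow> (\<Sum>b\<in>B. c b *
        (of_nat (multiplicity q (nat \<bar>num b\<bar>)) - of_nat (multiplicity q (den b)))) = 0"
      for c :: "int \<Rightarrow> rat"
    proof -
      have "\<forall>q\<in>S. (\<Sum>x\<in>B. c x * v x q) = 0" using that S(1) by (auto simp: v_def)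
      then show ?thesis using indep by blast
    qed
  qed (use fr B finB finG assms(5) in auto)
  then have "card S \<le> s1 p k t" using rank_le_s1 rpos cardG SB by (simp add: r_def)
  \<comment> \<open>Padding \<open>S\<close> with further primes to exactly \<open>s1 p k t\<close>
    elements stands in for monotonicity of \<open>Phi_tilde\<close> in its second argument; a larger
    set of coordinates still determines the vectors.\<close>
  moreover have "infinite ({q::nat. prime q} - S)"
    using primes_infinite S(2) by (simp add: Diff_infinite_finite)
  then obtain S' where S': "finite S'" "card S' = s1 p k t - card S" "S' \<subseteq> {q. prime q} - S"
    using infinite_arbitrarily_large by blast
  define T where "T = S \<union> S'"
  have "card T = card S + card S'" unfolding T_def using S S' by (intro card_Un_disjoint) auto
  ultimately have cardT: "card T = s1 p k t" using S' by simp
  have T: "finite T" "\<And>q. q \<in> T \<Longrightarrow> prime q" using S S' by (auto simp: T_def)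
  define F where "F x = (smooth_part T (nat \<bar>num x\<bar>), smooth_part T (den x))" for x
  \<comment> \<open>Equal smooth parts give equal exponents on \<open>S\<close>, hence at all primes
    by \<open>det\<close>; so the denominators agree and the numerators agree up to sign.\<close>
  have inj: "integer_height p x = integer_height p y" if x: "x \<in> V" and y: "y \<in> V" and eq: "F x = F y" for x y
  proof -
    have "v x q = v y q" if "q \<in> S" for q
    proof -
      have q: "q \<in> T" "prime q" using that S by (auto simp: T_def)
      have "multiplicity q (nat \<bar>num x\<bar>) = multiplicity q (nat \<bar>num y\<bar>)"
        "multiplicity q (den x) = multiplicity q (den y)"
        using multiplicity_smooth_part[OF T q(2)] eq q(1) unfolding F_def by (metis prod.inject)+
      then show ?thesis by (simp add: v_def)
    qed
    then have "v x q = v y q" if "prime q" for q using det x y that by blast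
    then have mult: "multiplicity q (nat \<bar>num x\<bar>) = multiplicity q (nat \<bar>num y\<bar>)
        \<and> multiplicity q (den x) = multiplicity q (den y)" if "prime q" for q
      using coprime_fraction_multiplicity_eq fr[OF x] fr[OF y] that unfolding v_def by blast
    have pos: "nat \<bar>num x\<bar> > 0" "nat \<bar>num y\<bar> > 0" "den x > 0" "den y > 0"
      using fr[OF x] fr[OF y] by simp_all
    have "nat \<bar>num x\<bar> = nat \<bar>num y\<bar>"
      using mult by (intro multiplicity_eq_nat[OF pos(1,2)]) blast
    then have num: "num x = num y \<or> num x = - num y" by linarith
    have den: "den x = den y"
      using mult by (intro multiplicity_eq_nat[OF pos(3,4)]) blast
    \<comment> \<open>Since \<open>0 < den x \<le> k < p\<close>, the common denominator can be
      cancelled modulo \<open>p\<close>.\<close>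
    have "coprime (den x) p"
      using fr[OF x] kp assms(1) by (metis coprime_commute nat_dvd_not_less prime_imp_coprime le_less_trans)
    then have cop: "coprime (int (den x)) (int p)" by simp
    from num show ?thesis
    proof
      assume "num x = num y"
      then have "[int (den x) * x = int (den x) * y] (mod int p)"
        using fr[OF x] fr[OF y] den cong_sym cong_trans by metis
      then show ?thesis using cop by (intro integer_height_cong) (simp add: cong_mult_lcancel)
    next
      assume "num x = - num y"
      moreover have "[- num y = int (den x) * (- y)] (mod int p)"
        using fr[OF y] den by (simp add: cong_minus_minus_iff)
      ultimately have "[int (den x) * x = int (den x) * (- y)] (mod int p)"
        using fr[OF x] cong_sym cong_trans by metis
      then have "integer_height p x = integer_height p (- y)"
        using cop by (intro integer_height_cong) (simp only: cong_mult_lcancel)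
      then show ?thesis by (simp add: integer_height_minus)
    qed
  qed
  define C where "C = {(u, v). u \<in> smooth_upto k T \<and> v \<in> smooth_upto k T \<and> coprime u v}"
  have "finite C"
    by (rule finite_subset[of _ "smooth_upto k T \<times> smooth_upto k T"]) (auto simp: C_def)
  have FC: "F ` V \<subseteq> C"
  proof
    fix z assume "z \<in> F ` V"
    then obtain x where x: "x \<in> V" "z = F x" by blast
    have pos: "nat \<bar>num x\<bar> > 0" "den x > 0" using fr[OF x(1)] by auto
    then have "coprime (smooth_part T (nat \<bar>num x\<bar>)) (smooth_part T (den x))"
      using fr[OF x(1)] smooth_part_dvd[OF T] coprime_divisors by blast
    then show "z \<in> C"
      using x pos fr[OF x(1)] smooth_part_in_smooth_upto[OF T] by (auto simp: C_def F_def)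
  qed
  \<comment> \<open>\<open>F\<close> need not be injective on \<open>V\<close>, as \<open>x\<close>
    and \<open>p - x\<close> can share an image, but the height factors through \<open>F\<close>:
    whichever preimage \<open>inv_into\<close> selects has the same height.\<close>
  have "integer_height p ` V \<subseteq> (\<lambda>z. integer_height p (inv_into V F z)) ` C"
  proof
    fix h assume "h \<in> integer_height p ` V"
    then obtain x where x: "x \<in> V" "h = integer_height p x" by blast
    have "inv_into V F (F x) \<in> V" "F (inv_into V F (F x)) = F x"
      using x(1) by (auto intro: inv_into_into f_inv_into_f)
    then have "h = integer_height p (inv_into V F (F x))" using inj x by metis
    then show "h \<in> (\<lambda>z. integer_height p (inv_into V F z)) ` C" using FC x(1) by blast
  qed
  then have "card (integer_height p ` V) \<le> card C" using \<open>finite C\<close> by (intro surj_card_le)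
  also have "\<dots> \<le> Phi_tilde k (s1 p k t)"
    unfolding C_def using card_coprime_smooth_pairs_le[OF T] cardT by simp
  finally show ?thesis by (simp add: V_def)
qed

end
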